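(* Let $R$ be a finite ring with unity. Then: (i) for $x \in R$, we have $x \in R^*$ if and only if $\mathrm{Prob}_x(R)=\frac{|R^*|}{|R|^2}$; (ii) if $x \in R$ satisfies $0 \neq x \notin R^*$, then $$\frac{|R^*|}{|R|^2} \cdot \frac{2+|Z(R)|}{|Z(R)|} \leq \mathrm{Prob}_x(R) \leq \frac{|R|-2|Z(R)|+|Z(R)|^2}{|R|^2};$$ (iii) $$\frac{2|R|+|Z(R)|-2}{|R|^2} \leq \mathrm{Prob}_0(R) \leq \frac{2|R|-2|Z(R)|+|Z(R)|^2}{|R|^2}.$$
   Context: Rings are associative with unity $1$, not necessarily commutative. For a finite ring $R$ and $x \in R$, the multiplication probability is $\mathrm{Prob}_x(R)=\frac{|\{(a,b) \in R^2 : ab=x\}|}{|R|^2}$. $R^*$ denotes the group of units of $R$, and $Z(R)=\{x \in R : \text{there exists } 0 \neq y \in R \text{ such that } xy=0 \text{ or } yx=0\}$ is the set of zero-divisors (so $0 \in Z(R)$ when $R\neq 0$). *)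

theory Defs
  imports Complex_Main "HOL-Algebra.Ring"
begin

definition mult_prob :: "('a, 'm) ring_scheme \<Rightarrow> 'a \<Rightarrow> real" where
  "mult_prob R x =
     real (card {(a, b) \<in> carrier R \<times> carrier R. a \<otimes>\<^bsub>R\<^esub> b = x}) / real (card (carrier R)) ^ 2"

text \<open>Left and right zero-divisors together. Zero is included exactly when the ring is nontrivial.\<close>

definition zero_divs :: "('a, 'm) ring_scheme \<Rightarrow> 'a set" where
  "zero_divs R =
     {x \<in> carrier R. \<exists>y \<in> carrier R. y \<noteq> \<zero>\<^bsub>R\<^esub> \<and> (x \<otimes>\<^bsub>R\<^esub> y = \<zero>\<^bsub>R\<^esub> \<or> y \<otimes>\<^bsub>R\<^esub> x = \<zero>\<^bsub>R\<^esub>)}"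

end

theory Submission
  imports Defs
begin

text \<open>
  Write \<open>n\<close>, \<open>u\<close>, \<open>z\<close> for the numbers of elements, units and zero-divisors.  A finite nontrivial ring
  is the disjoint union of its units and its zero-divisors, because multiplication by an element that
  is not a zero-divisor is injective and hence surjective; so \<open>n = u + z\<close>.

  The pairs with product \<open>x\<close> are counted by their first factor \<open>a\<close>.  A unit \<open>a\<close> contributes exactly one
  pair, and \<open>a = \<zero>\<close> contributes none if \<open>x \<noteq> \<zero>\<close> and all \<open>n\<close> if \<open>x = \<zero>\<close>.  For a nonzero zero-divisor
  \<open>a\<close> the solutions \<open>b\<close> of \<open>a \<otimes> b = x\<close> are none or a translate of the right annihilator of \<open>a\<close>,
  which has at least two and at most \<open>z\<close> elements.  Summing over \<open>a\<close> gives the two upper bounds and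
  the lower bound for \<open>x = \<zero>\<close>.

  If \<open>x\<close> is a unit, both factors are units, so there are exactly \<open>u\<close> pairs.  If \<open>x\<close> is not a
  unit, the pairs with first factor a unit and those with second factor a unit are disjoint families
  of \<open>u\<close> pairs each, so there are at least \<open>2u > u\<close> pairs; thus the count determines whether \<open>x\<close> is
  a unit.  If moreover \<open>x \<noteq> \<zero>\<close>, then \<open>\<zero>\<close> and \<open>x\<close> are two zero-divisors, so \<open>z \<ge> 2\<close> and
  \<open>u (2 + z) / z \<le> 2u\<close>, which is the remaining lower bound.
\<close>

text \<open>The ordered factorizations of \<open>x\<close>, that is, the pairs counted by \<^const>\<open>mult_prob\<close>.\<close>

definition factor_pairs :: "('a, 'm) ring_scheme \<Rightarrow> 'a \<Rightarrow> ('a \<times> 'a) set" where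
  "factor_pairs R x = {(a, b) \<in> carrier R \<times> carrier R. a \<otimes>\<^bsub>R\<^esub> b = x}"

text \<open>The elements \<open>b\<close> with \<open>a \<otimes> b = x\<close>; for \<open>x = \<zero>\<close> this is the right annihilator of \<open>a\<close>.\<close>

definition right_factors :: "('a, 'm) ring_scheme \<Rightarrow> 'a \<Rightarrow> 'a \<Rightarrow> 'a set" where
  "right_factors R a x = {b \<in> carrier R. a \<otimes>\<^bsub>R\<^esub> b = x}"

lemma mult_prob_altdef:
  "mult_prob R x = real (card (factor_pairs R x)) / real (card (carrier R)) ^ 2"
  by (simp add: mult_prob_def factor_pairs_def)

context ring
begin

section \<open>Units and zero-divisors of a finite ring\<close>

text \<open>Left multiplication by the right inverse \<open>b\<close> of \<open>a\<close> is injective, hence surjective, so \<open>b\<close> also has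
  a right inverse, which must be \<open>a\<close>.\<close>

lemma finite_right_inverse_imp_Unit:
  assumes fin: "finite (carrier R)" and a: "a \<in> carrier R" and b: "b \<in> carrier R"
    and ab: "a \<otimes> b = \<one>"
  shows "a \<in> Units R"
proof -
  have "inj_on (\<lambda>c. b \<otimes> c) (carrier R)"
  proof (rule inj_onI)
    fix c d assume c: "c \<in> carrier R" and d: "d \<in> carrier R" and eq: "b \<otimes> c = b \<otimes> d"
    have "(a \<otimes> b) \<otimes> c = (a \<otimes> b) \<otimes> d"
      using a b c d eq by (simp add: m_assoc)
    then show "c = d" using ab c d by simp
  qed
  moreover have "(\<lambda>c. b \<otimes> c) ` carrier R \<subseteq> carrier R" using b by auto
  ultimately have "(\<lambda>c. b \<otimes> c) ` carrier R = carrier R"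
    using fin endo_inj_surj by blast
  then obtain c where c: "c \<in> carrier R" and bc: "b \<otimes> c = \<one>"
    by (metis imageE one_closed)
  have "a = (a \<otimes> b) \<otimes> c"
    using a b c bc by (simp add: m_assoc)
  then have "a = c" using ab c by simp
  then show ?thesis using a b ab bc unfolding Units_def by blast
qed

lemma finite_Unit_mult_imp_Unit_left:
  assumes fin: "finite (carrier R)" and a: "a \<in> carrier R" and b: "b \<in> carrier R"
    and ab: "a \<otimes> b \<in> Units R"
  shows "a \<in> Units R"
proof (rule finite_right_inverse_imp_Unit[OF fin a])
  show "b \<otimes> inv (a \<otimes> b) \<in> carrier R" using b ab by simp
  show "a \<otimes> (b \<otimes> inv (a \<otimes> b)) = \<one>"
    using a b ab by (simp add: m_assoc[symmetric])
qed

lemma finite_trivial_right_annihilator_imp_Unit: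
  assumes fin: "finite (carrier R)" and a: "a \<in> carrier R"
    and ann: "right_factors R a \<zero> \<subseteq> {\<zero>}"
  shows "a \<in> Units R"
proof -
  have "inj_on (\<lambda>c. a \<otimes> c) (carrier R)"
  proof (rule inj_onI)
    fix c d assume c: "c \<in> carrier R" and d: "d \<in> carrier R" and eq: "a \<otimes> c = a \<otimes> d"
    then have "a \<otimes> (c \<ominus> d) = \<zero>"
      using a by (simp add: minus_eq r_distr r_minus r_neg)
    then have "c \<ominus> d = \<zero>" using ann c d unfolding right_factors_def by auto
    moreover have "c = (c \<ominus> d) \<oplus> d" using c d by (simp add: minus_eq a_assoc l_neg)
    ultimately show "c = d" using d by simp
  qed
  moreover have "(\<lambda>c. a \<otimes> c) ` carrier R \<subseteq> carrier R" using a by auto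
  ultimately have "(\<lambda>c. a \<otimes> c) ` carrier R = carrier R"
    using fin endo_inj_surj by blast
  then obtain c where "c \<in> carrier R" "a \<otimes> c = \<one>"
    by (metis imageE one_closed)
  then show ?thesis using finite_right_inverse_imp_Unit[OF fin a] by blast
qed

lemma Unit_not_zero_div:
  assumes "a \<in> Units R"
  shows "a \<notin> zero_divs R"
proof
  assume "a \<in> zero_divs R"
  then obtain y where y: "y \<in> carrier R" "y \<noteq> \<zero>" and "a \<otimes> y = \<zero> \<or> y \<otimes> a = \<zero>"
    unfolding zero_divs_def by blast
  then show False
  proof (elim disjE)
    assume "a \<otimes> y = \<zero>"
    then have "(inv a \<otimes> a) \<otimes> y = \<zero>" using assms y by (simp add: m_assoc Units_closed del: Units_l_inv)
    then show False using assms y by simp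
  next
    assume "y \<otimes> a = \<zero>"
    then have "y \<otimes> (a \<otimes> inv a) = \<zero>"
      using assms y by (simp add: m_assoc[symmetric] Units_closed del: Units_r_inv)
    then show False using assms y by simp
  qed
qed

lemma zero_in_zero_divs: "\<one> \<noteq> \<zero> \<Longrightarrow> \<zero> \<in> zero_divs R"
  unfolding zero_divs_def by auto

lemma finite_zero_divs_eq:
  assumes fin: "finite (carrier R)" and nt: "\<one> \<noteq> \<zero>"
  shows "zero_divs R = carrier R - Units R"
proof
  show "zero_divs R \<subseteq> carrier R - Units R"
    using Unit_not_zero_div unfolding zero_divs_def by blast
  show "carrier R - Units R \<subseteq> zero_divs R"
  proof
    fix a assume "a \<in> carrier R - Units R"
    then have a: "a \<in> carrier R" and "\<not> right_factors R a \<zero> \<subseteq> {\<zero>}"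
      using finite_trivial_right_annihilator_imp_Unit[OF fin] by blast+
    then show "a \<in> zero_divs R" unfolding right_factors_def zero_divs_def by blast
  qed
qed

lemma finite_card_carrier_eq:
  assumes fin: "finite (carrier R)" and nt: "\<one> \<noteq> \<zero>"
  shows "card (carrier R) = card (Units R) + card (zero_divs R)"
proof -
  have "Units R \<subseteq> carrier R" by auto
  then show ?thesis
    using fin by (simp add: finite_zero_divs_eq[OF fin nt] card_Diff_subset finite_subset card_mono)
qed

section \<open>Solutions of one linear equation\<close>

lemma right_factors_Unit:
  assumes "a \<in> Units R" and "x \<in> carrier R"
  shows "right_factors R a x = {inv a \<otimes> x}"
proof -
  have "b = inv a \<otimes> x" if "b \<in> carrier R" "a \<otimes> b = x" for b
  proof -
    have "inv a \<otimes> x = (inv a \<otimes> a) \<otimes> b"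
      using that assms by (simp add: m_assoc Units_closed del: Units_l_inv)
    then show ?thesis using that assms by simp
  qed
  moreover have "a \<otimes> (inv a \<otimes> x) = x"
    using assms by (simp add: m_assoc[symmetric] Units_closed)
  ultimately show ?thesis using assms unfolding right_factors_def by auto
qed

text \<open>If nonempty, the solution set of \<open>a \<otimes> b = x\<close> is a coset of the right annihilator of \<open>a\<close>.\<close>

lemma card_right_factors_le_annihilator:
  assumes fin: "finite (carrier R)" and a: "a \<in> carrier R"
  shows "card (right_factors R a x) \<le> card (right_factors R a \<zero>)"
proof (cases "right_factors R a x = {}")
  case False
  then obtain c where c: "c \<in> carrier R" "a \<otimes> c = x" unfolding right_factors_def by blast
  show ?thesis
  proof (rule card_inj_on_le)
    show "inj_on (\<lambda>b. b \<ominus> c) (right_factors R a x)"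
    proof (rule inj_onI)
      fix b d assume "b \<in> right_factors R a x" "d \<in> right_factors R a x" "b \<ominus> c = d \<ominus> c"
      then show "b = d" using c unfolding right_factors_def minus_eq by simp
    qed
    show "(\<lambda>b. b \<ominus> c) ` right_factors R a x \<subseteq> right_factors R a \<zero>"
      using a c unfolding right_factors_def by (auto simp: minus_eq r_distr r_minus r_neg)
    show "finite (right_factors R a \<zero>)" using fin unfolding right_factors_def by simp
  qed
qed simp

lemma finite_zero_divs: "finite (carrier R) \<Longrightarrow> finite (zero_divs R)"
  unfolding zero_divs_def by simp

lemma card_right_factors_le_zero_divs:
  assumes fin: "finite (carrier R)" and a: "a \<in> carrier R" "a \<noteq> \<zero>"
  shows "card (right_factors R a x) \<le> card (zero_divs R)"
proof -
  have "right_factors R a \<zero> \<subseteq> zero_divs R"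
    using a unfolding right_factors_def zero_divs_def by blast
  then have "card (right_factors R a \<zero>) \<le> card (zero_divs R)"
    using finite_zero_divs[OF fin] by (simp add: card_mono)
  with card_right_factors_le_annihilator[OF fin a(1)] show ?thesis by (rule le_trans)
qed

text \<open>Here \<open>a\<close> may be a zero-divisor on either side: by finiteness it still has a nonzero right
  annihilator.\<close>

lemma two_le_card_right_annihilator:
  assumes fin: "finite (carrier R)" and a: "a \<in> zero_divs R"
  shows "2 \<le> card (right_factors R a \<zero>)"
proof -
  have ac: "a \<in> carrier R" using a unfolding zero_divs_def by blast
  have "\<not> right_factors R a \<zero> \<subseteq> {\<zero>}"
    using finite_trivial_right_annihilator_imp_Unit[OF fin ac] Unit_not_zero_div a by blast
  then obtain y where y: "y \<in> right_factors R a \<zero>" "y \<noteq> \<zero>" by blast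
  have "{\<zero>, y} \<subseteq> right_factors R a \<zero>" using y ac unfolding right_factors_def by simp
  moreover have "finite (right_factors R a \<zero>)" using fin unfolding right_factors_def by simp
  ultimately have "card {\<zero>, y} \<le> card (right_factors R a \<zero>)" by (rule card_mono[rotated])
  then show ?thesis using y(2) by simp
qed

section \<open>Counting factorizations\<close>

lemma card_factor_pairs_eq_sum:
  assumes fin: "finite (carrier R)"
  shows "card (factor_pairs R x) = (\<Sum>a\<in>carrier R. card (right_factors R a x))"
proof -
  have "factor_pairs R x = (SIGMA a:carrier R. right_factors R a x)"
    unfolding factor_pairs_def right_factors_def by auto
  moreover have "\<forall>a\<in>carrier R. finite (right_factors R a x)"
    using fin unfolding right_factors_def by simp
  ultimately show ?thesis using fin by (simp add: card_SigmaI)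
qed

lemma card_factor_pairs:
  assumes fin: "finite (carrier R)" and nt: "\<one> \<noteq> \<zero>" and x: "x \<in> carrier R"
  shows "card (factor_pairs R x) =
    card (Units R) + card (right_factors R \<zero> x)
      + (\<Sum>a\<in>zero_divs R - {\<zero>}. card (right_factors R a x))"
proof -
  have split: "carrier R = Units R \<union> zero_divs R" "Units R \<inter> zero_divs R = {}"
    using finite_zero_divs_eq[OF fin nt] by auto
  have finU: "finite (Units R)" using split fin by (metis finite_Un)
  have finZ: "finite (zero_divs R)" using fin by (rule finite_zero_divs)
  have "card (factor_pairs R x)
      = (\<Sum>a\<in>Units R. card (right_factors R a x)) + (\<Sum>a\<in>zero_divs R. card (right_factors R a x))"
    unfolding card_factor_pairs_eq_sum[OF fin] split(1)
    using finU finZ split(2) by (rule sum.union_disjoint)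
  moreover have "(\<Sum>a\<in>Units R. card (right_factors R a x)) = card (Units R)"
    using x by (simp add: right_factors_Unit)
  moreover have "(\<Sum>a\<in>zero_divs R. card (right_factors R a x))
      = card (right_factors R \<zero> x) + (\<Sum>a\<in>zero_divs R - {\<zero>}. card (right_factors R a x))"
    using finZ zero_in_zero_divs[OF nt] by (rule sum.remove)
  ultimately show ?thesis by simp
qed

lemma right_factors_zero:
  "right_factors R \<zero> x = (if x = \<zero> then carrier R else {})"
  unfolding right_factors_def by auto

section \<open>Factorizations of units and of non-units\<close>

lemma card_factor_pairs_Unit:
  assumes fin: "finite (carrier R)" and x: "x \<in> Units R"
  shows "card (factor_pairs R x) = card (Units R)"
proof -
  have "factor_pairs R x = (\<lambda>a. (a, inv a \<otimes> x)) ` Units R"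
  proof (intro equalityI subsetI)
    fix p assume "p \<in> factor_pairs R x"
    then obtain a b where p: "p = (a, b)" and ab: "a \<in> carrier R" "b \<in> carrier R" "a \<otimes> b = x"
      unfolding factor_pairs_def by blast
    then have a: "a \<in> Units R" using finite_Unit_mult_imp_Unit_left[OF fin] x by blast
    moreover have "b = inv a \<otimes> x"
      using right_factors_Unit[OF a, of x] x ab unfolding right_factors_def by blast
    ultimately show "p \<in> (\<lambda>a. (a, inv a \<otimes> x)) ` Units R" using p by blast
  next
    fix p assume "p \<in> (\<lambda>a. (a, inv a \<otimes> x)) ` Units R"
    then show "p \<in> factor_pairs R x"
      using x unfolding factor_pairs_def by (auto simp: m_assoc[symmetric] Units_closed)
  qed
  moreover have "inj_on (\<lambda>a. (a, inv a \<otimes> x)) (Units R)" by (simp add: inj_on_def)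
  ultimately show ?thesis by (simp add: card_image)
qed

lemma card_factor_pairs_nonunit_ge:
  assumes fin: "finite (carrier R)" and x: "x \<in> carrier R" "x \<notin> Units R"
  shows "2 * card (Units R) \<le> card (factor_pairs R x)"
proof -
  let ?A = "(\<lambda>a. (a, inv a \<otimes> x)) ` Units R" and ?B = "(\<lambda>b. (x \<otimes> inv b, b)) ` Units R"
  have finU: "finite (Units R)" using fin by (rule finite_subset[rotated]) auto
  have "(x \<otimes> inv b) \<notin> Units R" if b: "b \<in> Units R" for b
  proof
    assume "x \<otimes> inv b \<in> Units R"
    then have "(x \<otimes> inv b) \<otimes> b \<in> Units R" using b by (rule Units_m_closed)
    then show False using b x by (simp add: m_assoc Units_closed)
  qed
  then have "?A \<inter> ?B = {}" by auto
  then have "card (?A \<union> ?B) = card ?A + card ?B" using finU by (simp add: card_Un_disjoint)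
  moreover have "card ?A = card (Units R)" "card ?B = card (Units R)"
    by (simp_all add: card_image inj_on_def)
  moreover have "card (?A \<union> ?B) \<le> card (factor_pairs R x)"
  proof (rule card_mono)
    show "finite (factor_pairs R x)"
      by (rule finite_subset[of _ "carrier R \<times> carrier R"]) (auto simp: factor_pairs_def fin)
    have "a \<otimes> (inv a \<otimes> x) = x" if "a \<in> Units R" for a
      using that x by (simp add: m_assoc[symmetric] Units_closed)
    moreover have "(x \<otimes> inv b) \<otimes> b = x" if "b \<in> Units R" for b
      using that x by (simp add: m_assoc Units_closed)
    ultimately show "?A \<union> ?B \<subseteq> factor_pairs R x" using x unfolding factor_pairs_def by auto
  qed
  ultimately show ?thesis by simp
qed

section \<open>Bounds in terms of the zero-divisors\<close>

lemma sum_card_right_factors_le: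
  assumes fin: "finite (carrier R)" and nt: "\<one> \<noteq> \<zero>"
  shows "real (\<Sum>a\<in>zero_divs R - {\<zero>}. card (right_factors R a x))
      \<le> real (card (zero_divs R)) ^ 2 - real (card (zero_divs R))"
proof -
  let ?z = "card (zero_divs R)"
  have z: "1 \<le> ?z"
    using zero_in_zero_divs[OF nt] finite_zero_divs[OF fin]
    by (metis One_nat_def Suc_leI card_gt_0_iff empty_iff)
  have "(\<Sum>a\<in>zero_divs R - {\<zero>}. card (right_factors R a x))
      \<le> card (zero_divs R - {\<zero>}) * ?z"
    using sum_bounded_above[of "zero_divs R - {\<zero>}" "\<lambda>a. card (right_factors R a x)" ?z]
      card_right_factors_le_zero_divs[OF fin] by (auto simp: zero_divs_def)
  also have "\<dots> = (?z - 1) * ?z"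
    using zero_in_zero_divs[OF nt] finite_zero_divs[OF fin] by (simp add: card_Diff_singleton)
  finally have "real (\<Sum>a\<in>zero_divs R - {\<zero>}. card (right_factors R a x)) \<le> real ((?z - 1) * ?z)"
    by (rule of_nat_mono)
  also have "\<dots> = real ?z ^ 2 - real ?z"
    using z by (simp add: of_nat_diff algebra_simps power2_eq_square)
  finally show ?thesis .
qed

lemma card_factor_pairs_nonzero_le:
  assumes fin: "finite (carrier R)" and nt: "\<one> \<noteq> \<zero>" and x: "x \<in> carrier R" "x \<noteq> \<zero>"
  shows "real (card (factor_pairs R x))
    \<le> real (card (carrier R)) - 2 * real (card (zero_divs R)) + real (card (zero_divs R)) ^ 2"
  using sum_card_right_factors_le[OF fin nt, of x] x(2)
  by (simp add: card_factor_pairs[OF fin nt x(1)] right_factors_zero finite_card_carrier_eq[OF fin nt])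

lemma card_factor_pairs_zero_le:
  assumes fin: "finite (carrier R)" and nt: "\<one> \<noteq> \<zero>"
  shows "real (card (factor_pairs R \<zero>))
    \<le> 2 * real (card (carrier R)) - 2 * real (card (zero_divs R)) + real (card (zero_divs R)) ^ 2"
  using sum_card_right_factors_le[OF fin nt, of \<zero>]
  by (simp add: card_factor_pairs[OF fin nt zero_closed] right_factors_zero
      finite_card_carrier_eq[OF fin nt])

lemma card_factor_pairs_zero_ge:
  assumes fin: "finite (carrier R)" and nt: "\<one> \<noteq> \<zero>"
  shows "2 * card (carrier R) + card (zero_divs R) \<le> card (factor_pairs R \<zero>) + 2"
proof -
  have "card (zero_divs R - {\<zero>}) * 2 \<le> (\<Sum>a\<in>zero_divs R - {\<zero>}. card (right_factors R a \<zero>))"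
    using sum_bounded_below[of "zero_divs R - {\<zero>}" 2 "\<lambda>a. card (right_factors R a \<zero>)"]
      two_le_card_right_annihilator[OF fin] by simp
  moreover have "card (zero_divs R - {\<zero>}) = card (zero_divs R) - 1"
    using zero_in_zero_divs[OF nt] finite_zero_divs[OF fin] by (simp add: card_Diff_singleton)
  ultimately show ?thesis
    by (simp add: card_factor_pairs[OF fin nt zero_closed] right_factors_zero
        finite_card_carrier_eq[OF fin nt])
qed

lemma card_factor_pairs_nonzero_nonunit_ge:
  assumes fin: "finite (carrier R)" and x: "x \<in> carrier R" "x \<noteq> \<zero>" "x \<notin> Units R"
  shows "real (card (Units R)) * ((2 + real (card (zero_divs R))) / real (card (zero_divs R)))
    \<le> real (card (factor_pairs R x))"
proof -
  let ?z = "real (card (zero_divs R))"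
  have nt: "\<one> \<noteq> \<zero>" using x one_zeroD by blast
  have "{\<zero>, x} \<subseteq> zero_divs R"
    using x zero_in_zero_divs[OF nt] finite_zero_divs_eq[OF fin nt] by auto
  then have "card {\<zero>, x} \<le> card (zero_divs R)"
    using finite_zero_divs[OF fin] by (rule card_mono[rotated])
  then have "2 \<le> ?z" using x(2) by simp
  then have "(2 + ?z) / ?z \<le> 2" by (simp add: divide_simps)
  then have "real (card (Units R)) * ((2 + ?z) / ?z) \<le> real (card (Units R)) * 2"
    by (rule mult_left_mono) simp
  then show ?thesis using card_factor_pairs_nonunit_ge[OF fin x(1) x(3)] by linarith
qed

section \<open>Recognizing units by their number of factorizations\<close>

lemma card_Units_pos:
  assumes fin: "finite (carrier R)"
  shows "0 < card (Units R)"
proof -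
  have "finite (Units R)" using fin by (rule finite_subset[rotated]) auto
  then show ?thesis using Units_one_closed card_gt_0_iff by blast
qed

lemma Unit_iff_card_factor_pairs:
  assumes fin: "finite (carrier R)" and x: "x \<in> carrier R"
  shows "x \<in> Units R \<longleftrightarrow> card (factor_pairs R x) = card (Units R)"
proof
  show "x \<in> Units R \<Longrightarrow> card (factor_pairs R x) = card (Units R)"
    by (rule card_factor_pairs_Unit[OF fin])
  show "x \<in> Units R" if "card (factor_pairs R x) = card (Units R)"
    using card_factor_pairs_nonunit_ge[OF fin x] card_Units_pos[OF fin] that by fastforce
qed

end

section \<open>Bounds for multiplication probabilities\<close>

theorem lemma2p4:
  fixes R :: "('a, 'm) ring_scheme" (structure)
  assumes "ring R" and "finite (carrier R)"
  shows "(\<forall>x \<in> carrier R.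
            x \<in> Units R \<longleftrightarrow>
            mult_prob R x = real (card (Units R)) / real (card (carrier R)) ^ 2)
       \<and> (\<forall>x \<in> carrier R. x \<noteq> \<zero> \<and> x \<notin> Units R \<longrightarrow>
            real (card (Units R)) / real (card (carrier R)) ^ 2
              * ((2 + real (card (zero_divs R))) / real (card (zero_divs R)))
              \<le> mult_prob R x
          \<and> mult_prob R x
              \<le> (real (card (carrier R)) - 2 * real (card (zero_divs R))
                  + real (card (zero_divs R)) ^ 2) / real (card (carrier R)) ^ 2)
       \<and> (2 * real (card (carrier R)) + real (card (zero_divs R)) - 2)
            / real (card (carrier R)) ^ 2
            \<le> mult_prob R \<zero>
       \<and> mult_prob R \<zero>
            \<le> (2 * real (card (carrier R)) - 2 * real (card (zero_divs R))
                + real (card (zero_divs R)) ^ 2) / real (card (carrier R)) ^ 2"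
proof -
  interpret ring R by (rule assms(1))
  note fin = assms(2)
  let ?n = "real (card (carrier R))" and ?u = "real (card (Units R))"
    and ?z = "real (card (zero_divs R))"
  have n: "0 < ?n ^ 2" using fin zero_closed by (auto simp: card_gt_0_iff)
  have "x \<in> Units R \<longleftrightarrow> mult_prob R x = ?u / ?n ^ 2" if "x \<in> carrier R" for x
    using Unit_iff_card_factor_pairs[OF fin that] n by (simp add: mult_prob_altdef)
  moreover have "?u / ?n ^ 2 * ((2 + ?z) / ?z) \<le> mult_prob R x
      \<and> mult_prob R x \<le> (?n - 2 * ?z + ?z ^ 2) / ?n ^ 2"
    if x: "x \<in> carrier R" "x \<noteq> \<zero>" "x \<notin> Units R" for x
  proof
    have "?u * ((2 + ?z) / ?z) / ?n ^ 2 \<le> mult_prob R x"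
      unfolding mult_prob_altdef
      by (rule divide_right_mono[OF card_factor_pairs_nonzero_nonunit_ge[OF fin x]]) simp
    then show "?u / ?n ^ 2 * ((2 + ?z) / ?z) \<le> mult_prob R x" by (simp add: mult.commute)
    have "\<one> \<noteq> \<zero>" using x one_zeroD by blast
    then show "mult_prob R x \<le> (?n - 2 * ?z + ?z ^ 2) / ?n ^ 2"
      unfolding mult_prob_altdef
      using card_factor_pairs_nonzero_le[OF fin _ x(1,2)] by (intro divide_right_mono) simp_all
  qed
  moreover have "(2 * ?n + ?z - 2) / ?n ^ 2 \<le> mult_prob R \<zero>
      \<and> mult_prob R \<zero> \<le> (2 * ?n - 2 * ?z + ?z ^ 2) / ?n ^ 2"
  proof (cases "\<one> = \<zero>")
    case True
    \<comment> \<open>In the trivial ring \<open>\<zero>\<close> is not a zero-divisor, so \<open>z = 0\<close> and the bounds read \<open>0 \<le> 1 \<le> 2\<close>.\<close>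
    then have carrier: "carrier R = {\<zero>}" by (rule one_zeroD)
    then have "zero_divs R = {}" "factor_pairs R \<zero> = {(\<zero>, \<zero>)}"
      unfolding zero_divs_def factor_pairs_def by auto
    then show ?thesis by (simp add: mult_prob_altdef carrier)
  next
    case False
    have "2 * ?n + ?z - 2 \<le> real (card (factor_pairs R \<zero>))"
      using card_factor_pairs_zero_ge[OF fin False] by linarith
    then show ?thesis
      unfolding mult_prob_altdef using card_factor_pairs_zero_le[OF fin False]
      by (intro conjI divide_right_mono) simp_all
  qed
  ultimately show ?thesis by blast
qed

end
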